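(* Let $P_n$ and $C_n$ be, respectively, the path and cycle graphs on $n$ vertices, and let $P_\infty$ and $C_\infty$ be, respectively, the infinite path and infinite cycle graphs. Let $K_{n,n}$ be the complete bipartite graph with both parts of size $n$. Then the spectral radii of their $2$-token graphs satisfy the following. (i) $\rho(F_2(P_n))\le 4\cos(\pi/n)$ and $\rho(F_2(P_\infty))=4$. (ii) $\rho(F_2(C_n))= 4\cos(\pi/n)$ and $\rho(F_2(C_\infty))=4$. (iii) $\rho(F_2(K_{n,n}))= 2\sqrt{n(n-1)}$.
   Context: For a graph $H$, $\rho(H)$ denotes the spectral radius of the adjacency matrix of $H$ (for finite $H$, its largest eigenvalue). For a simple graph $G=(V,E)$, the $2$-token graph $F_2(G)$ has as vertices the $2$-subsets of $V$, and two $2$-subsets $A,B$ are adjacent if and only if their symmetric difference is a pair $\{a,b\}$ with $a\in A$, $b\in B$ and $\{a,b\}\in E$. *)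

theory Defs
  imports "HOL-Analysis.Analysis"
begin

section \<open>Graphs and 2-token graphs\<close>

text \<open>Undirected simple graphs, possibly infinite; the edges are 2-element sets of vertices.\<close>

record 'a ugraph =
  verts :: "'a set"
  edges :: "'a set set"

definition token2 :: "'a ugraph \<Rightarrow> 'a set ugraph" where
  "token2 G = (let V2 = {A. A \<subseteq> verts G \<and> card A = 2} in
     \<lparr> verts = V2,
       edges = {{A, B} | A B. A \<in> V2 \<and> B \<in> V2 \<and>
                  (\<exists>a\<in>A. \<exists>b\<in>B. sym_diff A B = {a, b} \<and> {a, b} \<in> edges G)} \<rparr>)"

definition path_graph :: "nat \<Rightarrow> nat ugraph" where
  "path_graph n = \<lparr> verts = {..<n}, edges = {{i, i + 1} | i. i + 1 < n} \<rparr>"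

text \<open>This is a cycle (and a simple graph) only for \<open>n \<ge> 3\<close>.\<close>

definition cycle_graph :: "nat \<Rightarrow> nat ugraph" where
  "cycle_graph n = \<lparr> verts = {..<n}, edges = {{i, (i + 1) mod n} | i. i < n} \<rparr>"

definition complete_bipartite_graph :: "nat \<Rightarrow> nat \<Rightarrow> (nat + nat) ugraph" where
  "complete_bipartite_graph m n =
     \<lparr> verts = {..<m} <+> {..<n}, edges = {{Inl i, Inr j} | i j. i < m \<and> j < n} \<rparr>"

text \<open>The infinite path is the one-way infinite path (ray); the infinite cycle is the 2-regular
  connected infinite graph, that is, the two-way infinite path on the integers.\<close>

definition inf_path_graph :: "nat ugraph" where
  "inf_path_graph = \<lparr> verts = UNIV, edges = {{i, i + 1} | i. True} \<rparr>"

definition inf_cycle_graph :: "int ugraph" where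
  "inf_cycle_graph = \<lparr> verts = UNIV, edges = {{i, i + 1} | i. True} \<rparr>"

section \<open>Bounded operators on square-summable functions and their spectrum\<close>

text \<open>Functions on \<open>V\<close> are represented by functions on the whole type that vanish outside \<open>V\<close>.
  For finite \<open>V\<close> the space below consists of all complex vectors indexed by \<open>V\<close>.\<close>

definition ell2 :: "'a set \<Rightarrow> ('a \<Rightarrow> complex) set" where
  "ell2 V = {f. (\<forall>v. v \<notin> V \<longrightarrow> f v = 0) \<and> (\<lambda>v. (cmod (f v))\<^sup>2) summable_on V}"

definition ell2_norm :: "'a set \<Rightarrow> ('a \<Rightarrow> complex) \<Rightarrow> real" where
  "ell2_norm V f = sqrt (\<Sum>\<^sub>\<infinity>v\<in>V. (cmod (f v))\<^sup>2)"

definition bounded_op :: "'a set \<Rightarrow> (('a \<Rightarrow> complex) \<Rightarrow> ('a \<Rightarrow> complex)) \<Rightarrow> bool" where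
  "bounded_op V T \<longleftrightarrow>
     (\<forall>f\<in>ell2 V. T f \<in> ell2 V) \<and>
     (\<forall>f\<in>ell2 V. \<forall>g\<in>ell2 V. T (\<lambda>v. f v + g v) = (\<lambda>v. T f v + T g v)) \<and>
     (\<forall>c. \<forall>f\<in>ell2 V. T (\<lambda>v. c * f v) = (\<lambda>v. c * T f v)) \<and>
     (\<exists>C. \<forall>f\<in>ell2 V. ell2_norm V (T f) \<le> C * ell2_norm V f)"

text \<open>\<open>z\<close> is in the spectrum iff \<open>z I - T\<close> has no bounded two-sided inverse. For finite \<open>V\<close> every
  linear operator is bounded, so this says that the matrix \<open>z I - T\<close> is singular, that is,
  that \<open>z\<close> is an eigenvalue.\<close>

definition op_spectrum ::
    "'a set \<Rightarrow> (('a \<Rightarrow> complex) \<Rightarrow> ('a \<Rightarrow> complex)) \<Rightarrow> complex set" where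
  "op_spectrum V T = {z. \<not> (\<exists>R. bounded_op V R \<and>
     (\<forall>f\<in>ell2 V. R (\<lambda>v. z * f v - T f v) = f \<and> (\<lambda>v. z * R f v - T (R f) v) = f))}"

section \<open>Spectral radius of a graph\<close>

definition adj_matrix :: "'a ugraph \<Rightarrow> 'a \<Rightarrow> 'a \<Rightarrow> complex" where
  "adj_matrix G u v = (if {u, v} \<in> edges G then 1 else 0)"

text \<open>Multiplication by the adjacency matrix. If the vertex degrees are bounded, each sum has
  finitely many nonzero terms and this is a bounded operator.\<close>

definition adj_op :: "'a ugraph \<Rightarrow> ('a \<Rightarrow> complex) \<Rightarrow> ('a \<Rightarrow> complex)" where
  "adj_op G f v = (if v \<in> verts G then \<Sum>\<^sub>\<infinity>u\<in>verts G. adj_matrix G v u * f u else 0)"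

text \<open>The supremum of the moduli of the spectral values. It is meaningful for nonempty graphs of
  bounded degree, whose spectrum is nonempty and bounded; for finite graphs it is the largest
  eigenvalue.\<close>

definition spectral_radius :: "'a ugraph \<Rightarrow> real" where
  "spectral_radius G = (SUP z \<in> op_spectrum (verts G) (adj_op G). cmod z)"

end

theory Submission imports Defs begin

text \<open>
  If a positive weight \<open>w\<close> satisfies \<open>A w \<le> l w\<close> pointwise for the adjacency operator \<open>A\<close>, then the
  Schur test gives \<open>\<parallel>A\<parallel> \<le> l\<close>, and a Neumann series confines the spectrum to the disc of radius \<open>l\<close>.
  A symmetric function \<open>h\<close> on pairs vanishing on the diagonal turns the adjacency operator of a
  2-token graph into the sum of the adjacency operators of the graph in each variable. For
  \<open>P\<^sub>n\<close> and \<open>C\<^sub>n\<close> the weight is \<open>\<bar>sin (pi (i - j) / n)\<bar>\<close>, which is an eigenfunction for \<open>C\<^sub>n\<close>; for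
  \<open>K\<^sub>n\<^sub>,\<^sub>n\<close> it takes one value on pairs inside a part and another on pairs across the parts; for the infinite
  graphs it is constant, and indicators of large boxes show that 4 is an approximate eigenvalue.
\<close>

section \<open>Adjacency operators on square-summable functions\<close>

definition nbhd :: "'a ugraph \<Rightarrow> 'a \<Rightarrow> 'a set" where
  "nbhd G v = {u \<in> verts G. {v, u} \<in> edges G}"

lemma nbhd_sym: "u \<in> nbhd G v \<Longrightarrow> v \<in> verts G \<Longrightarrow> v \<in> nbhd G u"
  by (simp add: nbhd_def insert_commute)

lemma adj_op_nbhd:
  assumes "finite (nbhd G v)" "v \<in> verts G"
  shows "adj_op G f v = (\<Sum>u\<in>nbhd G v. f u)"
proof -
  have "(\<Sum>\<^sub>\<infinity>u\<in>verts G. adj_matrix G v u * f u) = (\<Sum>\<^sub>\<infinity>u\<in>nbhd G v. f u)"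
    by (rule infsum_cong_neutral) (auto simp: nbhd_def adj_matrix_def)
  with assms show ?thesis
    by (simp add: adj_op_def)
qed

lemma adj_op_outside: "v \<notin> verts G \<Longrightarrow> adj_op G f v = 0"
  by (simp add: adj_op_def)

section \<open>Norm estimates for square-summable functions\<close>

lemma ell2_outside: "f \<in> ell2 V \<Longrightarrow> v \<notin> V \<Longrightarrow> f v = 0"
  by (simp add: ell2_def)

lemma ell2_scale: "f \<in> ell2 V \<Longrightarrow> (\<lambda>v. c * f v) \<in> ell2 V"
  by (auto simp: ell2_def norm_mult power_mult_distrib intro: summable_on_cmult_right)

lemma ell2_norm_nonneg: "0 \<le> ell2_norm V f"
  by (simp add: ell2_norm_def infsum_nonneg)

lemma L2_set_le_ell2_norm:
  assumes "f \<in> ell2 V" "finite F" "F \<subseteq> V"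
  shows "L2_set (\<lambda>v. cmod (f v)) F \<le> ell2_norm V f"
  using assms unfolding L2_set_def ell2_norm_def ell2_def
  by (intro real_sqrt_le_mono finite_sum_le_infsum) auto

lemma norm_le_ell2_norm:
  assumes "f \<in> ell2 V"
  shows "cmod (f v) \<le> ell2_norm V f"
proof (cases "v \<in> V")
  case True
  then show ?thesis
    using L2_set_le_ell2_norm[OF assms, of "{v}"] by simp
next
  case False
  then show ?thesis
    using assms by (simp add: ell2_outside ell2_norm_nonneg)
qed

text \<open>Bounded finite sections give square-summability and the norm bound together, so the
  operator estimates below are proved with \<open>L2_set\<close> on finite sets.\<close>

lemma ell2_boundI:
  assumes "\<And>v. v \<notin> V \<Longrightarrow> f v = 0"
    and bound: "\<And>F. finite F \<Longrightarrow> F \<subseteq> V \<Longrightarrow> L2_set (\<lambda>v. cmod (f v)) F \<le> C"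
  shows "f \<in> ell2 V" "ell2_norm V f \<le> C"
proof -
  have C: "0 \<le> C"
    using bound[of "{}"] by simp
  have *: "(\<Sum>v\<in>F. (cmod (f v))\<^sup>2) \<le> C\<^sup>2" if "finite F" "F \<subseteq> V" for F
    using power_mono[OF bound[OF that], of 2] by (simp add: L2_set_def sum_nonneg)
  have s: "(\<lambda>v. (cmod (f v))\<^sup>2) summable_on V"
    by (rule nonneg_bdd_above_summable_on) (auto intro!: bdd_aboveI[of _ "C\<^sup>2"] *)
  with assms(1) show "f \<in> ell2 V"
    by (simp add: ell2_def)
  have "(\<Sum>\<^sub>\<infinity>v\<in>V. (cmod (f v))\<^sup>2) \<le> C\<^sup>2"
    using s * by (rule infsum_le_finite_sums)
  with C show "ell2_norm V f \<le> C"
    by (simp add: ell2_norm_def real_le_lsqrt)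
qed

lemma ell2_finite_support:
  assumes "finite S" "S \<subseteq> V" "\<And>v. v \<notin> S \<Longrightarrow> f v = 0"
  shows "f \<in> ell2 V" "ell2_norm V f = L2_set (\<lambda>v. cmod (f v)) S"
proof -
  have "(\<lambda>v. (cmod (f v))\<^sup>2) summable_on S"
    using assms by simp
  then have "(\<lambda>v. (cmod (f v))\<^sup>2) summable_on V"
    by (rule summable_on_cong_neutral[THEN iffD1, rotated -1]) (use assms in auto)
  with assms show "f \<in> ell2 V"
    by (auto simp: ell2_def)
  have "(\<Sum>\<^sub>\<infinity>v\<in>V. (cmod (f v))\<^sup>2) = (\<Sum>\<^sub>\<infinity>v\<in>S. (cmod (f v))\<^sup>2)"
    by (rule infsum_cong_neutral) (use assms in auto)
  with assms show "ell2_norm V f = L2_set (\<lambda>v. cmod (f v)) S"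
    by (simp add: ell2_norm_def L2_set_def)
qed

section \<open>Criteria for membership in the spectrum\<close>

lemma bounded_op_zero:
  assumes "bounded_op V R" "f \<in> ell2 V"
  shows "R (\<lambda>v. 0) = (\<lambda>v. 0)"
proof -
  have "R (\<lambda>v. 0 * f v) = (\<lambda>v. 0 * R f v)"
    using assms unfolding bounded_op_def by blast
  then show ?thesis
    by simp
qed

text \<open>A left inverse of \<open>z I - T\<close> would send the zero function to
  \<open>f\<close>, whereas homogeneity sends it to zero.\<close>

lemma eigenvalue_in_op_spectrum:
  assumes "f \<in> ell2 V" "T f = (\<lambda>v. z * f v)" "f v \<noteq> 0"
  shows "z \<in> op_spectrum V T"
proof -
  have False if "bounded_op V R" "\<forall>f\<in>ell2 V. R (\<lambda>v. z * f v - T f v) = f" for R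
  proof -
    have "R (\<lambda>v. 0) = f"
      using that(2)[rule_format, OF assms(1)] assms(2) by simp
    with bounded_op_zero[OF that(1) assms(1)] assms(3) show False
      by auto
  qed
  then show ?thesis
    unfolding op_spectrum_def by blast
qed

text \<open>A left inverse bounded with constant \<open>C\<close> would make the norm of
  \<open>f\<close> at most \<open>C\<close> times that of \<open>z f - T f\<close>; the hypothesis
  refutes this for every \<open>C\<close>.\<close>

lemma approximate_eigenvalue_in_op_spectrum:
  assumes "\<And>C::real. \<exists>f\<in>ell2 V. (\<lambda>v. z * f v - T f v) \<in> ell2 V \<and>
             C * ell2_norm V (\<lambda>v. z * f v - T f v) < ell2_norm V f"
  shows "z \<in> op_spectrum V T"
proof -
  have False if R: "bounded_op V R" "\<forall>f\<in>ell2 V. R (\<lambda>v. z * f v - T f v) = f" for R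
  proof -
    obtain C where C: "\<And>g. g \<in> ell2 V \<Longrightarrow> ell2_norm V (R g) \<le> C * ell2_norm V g"
      using R(1) unfolding bounded_op_def by blast
    obtain f where f: "f \<in> ell2 V" "(\<lambda>v. z * f v - T f v) \<in> ell2 V"
        "C * ell2_norm V (\<lambda>v. z * f v - T f v) < ell2_norm V f"
      using assms by blast
    with C[OF f(2)] R(2) show False
      by simp
  qed
  then show ?thesis
    unfolding op_spectrum_def by blast
qed

lemma L2_set_sum_le:
  fixes n :: nat
  shows   "L2_set (\<lambda>v. cmod (\<Sum>k<n. a k v)) F \<le> (\<Sum>k<n. L2_set (\<lambda>v. cmod (a k v)) F)"
proof (induction n)
  case (Suc n)
  have "L2_set (\<lambda>v. cmod (\<Sum>k<Suc n. a k v)) F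
      \<le> L2_set (\<lambda>v. cmod (\<Sum>k<n. a k v) + cmod (a n v)) F"
    by (intro L2_set_mono) (auto simp: norm_triangle_ineq)
  also have "\<dots> \<le> L2_set (\<lambda>v. cmod (\<Sum>k<n. a k v)) F + L2_set (\<lambda>v. cmod (a n v)) F"
    by (rule L2_set_triangle_ineq)
  finally show ?case
    using Suc by simp
qed (simp add: L2_set_def)

section \<open>Schur test and Neumann series\<close>

locale positive_supersolution =
  fixes G :: "'a ugraph" and w :: "'a \<Rightarrow> real" and l :: real
  assumes finite_nbhd: "v \<in> verts G \<Longrightarrow> finite (nbhd G v)"
    and weight_pos: "v \<in> verts G \<Longrightarrow> 0 < w v"
    and supersolution: "v \<in> verts G \<Longrightarrow> (\<Sum>u\<in>nbhd G v. w u) \<le> l * w v"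
    and l_nonneg: "0 \<le> l"
begin

abbreviation "V \<equiv> verts G"
abbreviation "T \<equiv> adj_op G"

lemma adj_op_add: "T (\<lambda>v. f v + g v) = (\<lambda>v. T f v + T g v)"
proof
  fix v show "T (\<lambda>v. f v + g v) v = T f v + T g v"
    by (cases "v \<in> V") (simp_all add: adj_op_nbhd finite_nbhd adj_op_outside sum.distrib)
qed

lemma adj_op_scale: "T (\<lambda>v. c * f v) = (\<lambda>v. c * T f v)"
proof
  fix v show "T (\<lambda>v. c * f v) v = c * T f v"
    by (cases "v \<in> V") (simp_all add: adj_op_nbhd finite_nbhd adj_op_outside sum_distrib_left)
qed

text \<open>Cauchy--Schwarz with the weights \<open>sqrt (w u)\<close> and \<open>1 / sqrt (w u)\<close>.\<close>

lemma norm_adj_op_square_le: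
  assumes "v \<in> V"
  shows "(cmod (T f v))\<^sup>2 \<le> l * w v * (\<Sum>u\<in>nbhd G v. (cmod (f u))\<^sup>2 / w u)"
proof -
  let ?N = "nbhd G v"
  have wp: "0 < w u" if "u \<in> ?N" for u
    using that weight_pos by (simp add: nbhd_def)
  have wp': "0 \<le> w u" if "u \<in> ?N" for u
    using wp[OF that] by simp
  have "cmod (T f v) \<le> (\<Sum>u\<in>?N. cmod (f u))"
    using assms by (simp add: adj_op_nbhd finite_nbhd norm_sum)
  also have "\<dots> = (\<Sum>u\<in>?N. \<bar>sqrt (w u)\<bar> * \<bar>cmod (f u) / sqrt (w u)\<bar>)"
    by (intro sum.cong refl) (simp add: wp wp' less_imp_neq[OF wp, symmetric])
  also have "\<dots> \<le> L2_set (\<lambda>u. sqrt (w u)) ?N * L2_set (\<lambda>u. cmod (f u) / sqrt (w u)) ?N"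
    by (rule L2_set_mult_ineq)
  finally have "(cmod (T f v))\<^sup>2 \<le>
      (L2_set (\<lambda>u. sqrt (w u)) ?N * L2_set (\<lambda>u. cmod (f u) / sqrt (w u)) ?N)\<^sup>2"
    by (simp add: power_mono)
  also have "\<dots> = (\<Sum>u\<in>?N. w u) * (\<Sum>u\<in>?N. (cmod (f u))\<^sup>2 / w u)"
    by (simp add: power_mult_distrib L2_set_def sum_nonneg power_divide wp')
  also have "\<dots> \<le> l * w v * (\<Sum>u\<in>?N. (cmod (f u))\<^sup>2 / w u)"
    by (intro mult_right_mono supersolution assms sum_nonneg divide_nonneg_nonneg)
       (simp_all add: wp')
  finally show ?thesis .
qed

text \<open>Schur test: summing the pointwise bound and exchanging the sums collects the weights
  \<open>w v\<close> over neighbours \<open>v\<close> of \<open>u\<close>. Since adjacency is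
  symmetric, \<open>supersolution\<close> applies a second time and supplies the other factor
  \<open>l\<close>.\<close>

lemma L2_set_adj_op_le:
  assumes f: "f \<in> ell2 V" and F: "finite F" "F \<subseteq> V"
  shows "L2_set (\<lambda>v. cmod (T f v)) F \<le> l * ell2_norm V f"
proof -
  let ?U = "\<Union>v\<in>F. nbhd G v"
  have U: "finite ?U" "?U \<subseteq> V"
    using F finite_nbhd by (auto simp: nbhd_def)
  have fin: "finite (nbhd G v)" if "v \<in> F" for v
    using that F finite_nbhd by blast
  have "(\<Sum>v\<in>F. (cmod (T f v))\<^sup>2) \<le> (\<Sum>v\<in>F. l * w v * (\<Sum>u\<in>nbhd G v. (cmod (f u))\<^sup>2 / w u))"
    using F by (intro sum_mono norm_adj_op_square_le) auto
  also have "\<dots> = (\<Sum>v\<in>F. \<Sum>u | u \<in> ?U \<and> u \<in> nbhd G v. l * w v * ((cmod (f u))\<^sup>2 / w u))"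
    by (simp only: sum_distrib_left) (intro sum.cong refl, auto)
  also have "\<dots> = (\<Sum>u\<in>?U. \<Sum>v | v \<in> F \<and> u \<in> nbhd G v. l * w v * ((cmod (f u))\<^sup>2 / w u))"
    using F(1) U(1) by (rule sum.swap_restrict)
  also have "\<dots> \<le> (\<Sum>u\<in>?U. l\<^sup>2 * (cmod (f u))\<^sup>2)"
  proof (rule sum_mono)
    fix u assume "u \<in> ?U"
    then have u: "u \<in> V" "0 < w u"
      using U weight_pos by blast+
    \<comment> \<open>Enlarging the index set to the whole neighbourhood of \<open>u\<close> only
      adds positive weights.\<close>
    have "(\<Sum>v | v \<in> F \<and> u \<in> nbhd G v. w v) \<le> (\<Sum>v\<in>nbhd G u. w v)"
    proof (rule sum_mono2)
      show "finite (nbhd G u)"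
        using u finite_nbhd by blast
      show "{v \<in> F. u \<in> nbhd G v} \<subseteq> nbhd G u"
        using F(2) nbhd_sym[of u G] by blast
      show "0 \<le> w v" if "v \<in> nbhd G u - {v \<in> F. u \<in> nbhd G v}" for v
        using that weight_pos[of v] by (simp add: nbhd_def)
    qed
    also have "\<dots> \<le> l * w u"
      using u supersolution by blast
    finally have "(\<Sum>v | v \<in> F \<and> u \<in> nbhd G v. w v) * (l * ((cmod (f u))\<^sup>2 / w u)) \<le>
        l * w u * (l * ((cmod (f u))\<^sup>2 / w u))"
      using u l_nonneg by (intro mult_right_mono) auto
    then show "(\<Sum>v | v \<in> F \<and> u \<in> nbhd G v. l * w v * ((cmod (f u))\<^sup>2 / w u)) \<le> l\<^sup>2 * (cmod (f u))\<^sup>2"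
      using u by (simp add: sum_distrib_left sum_distrib_right power2_eq_square mult_ac)
  qed
  finally have "(\<Sum>v\<in>F. (cmod (T f v))\<^sup>2) \<le> l\<^sup>2 * (\<Sum>u\<in>?U. (cmod (f u))\<^sup>2)"
    by (simp add: sum_distrib_left)
  then have "L2_set (\<lambda>v. cmod (T f v)) F \<le> sqrt (l\<^sup>2 * (\<Sum>u\<in>?U. (cmod (f u))\<^sup>2))"
    unfolding L2_set_def by (rule real_sqrt_le_mono)
  also have "\<dots> = l * L2_set (\<lambda>u. cmod (f u)) ?U"
    using l_nonneg by (simp add: L2_set_def real_sqrt_mult)
  also have "\<dots> \<le> l * ell2_norm V f"
    using f U l_nonneg by (intro mult_left_mono L2_set_le_ell2_norm)
  finally show ?thesis .
qed

lemma adj_op_ell2: "f \<in> ell2 V \<Longrightarrow> T f \<in> ell2 V"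
  and ell2_norm_adj_op: "f \<in> ell2 V \<Longrightarrow> ell2_norm V (T f) \<le> l * ell2_norm V f"
  using ell2_boundI[OF adj_op_outside L2_set_adj_op_le] by blast+

lemma adj_op_iterate:
  assumes "f \<in> ell2 V"
  shows "(T ^^ k) f \<in> ell2 V" "ell2_norm V ((T ^^ k) f) \<le> l ^ k * ell2_norm V f"
proof (induction k)
  case (Suc k)
  { case 1 show ?case using Suc.IH(1) by (simp add: adj_op_ell2) }
  { case 2
    have "ell2_norm V ((T ^^ Suc k) f) \<le> l * ell2_norm V ((T ^^ k) f)"
      using Suc.IH(1) by (simp add: ell2_norm_adj_op)
    also have "\<dots> \<le> l * (l ^ k * ell2_norm V f)"
      using Suc.IH(2) l_nonneg by (rule mult_left_mono)
    finally show ?case by (simp add: mult_ac) }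
qed (use assms in auto)

text \<open>The resolvent as a Neumann series, summed pointwise: completeness of the function space is
  then not needed.\<close>

definition resolvent :: "complex \<Rightarrow> ('a \<Rightarrow> complex) \<Rightarrow> 'a \<Rightarrow> complex" where
  "resolvent z f v = (\<Sum>k. (T ^^ k) f v / z ^ Suc k)"

context
  fixes z :: complex
  assumes z: "l < cmod z"
begin

lemma z_nonzero: "z \<noteq> 0"
  using z l_nonneg by auto

lemma geometric_bound_summable: "summable (\<lambda>k. l ^ k * c / cmod z ^ Suc k)"
proof -
  have "summable (\<lambda>k. (l / cmod z) ^ k * (c / cmod z))"
    using z l_nonneg z_nonzero by (intro summable_mult2 summable_geometric) simp
  then show ?thesis
    by (simp add: power_divide mult_ac)
qed

lemma resolvent_summable:
  assumes "f \<in> ell2 V"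
  shows "summable (\<lambda>k. (T ^^ k) f v / z ^ Suc k)"
proof (rule summable_comparison_test'[OF geometric_bound_summable])
  fix k
  have "cmod ((T ^^ k) f v) \<le> l ^ k * ell2_norm V f"
    by (rule order_trans[OF norm_le_ell2_norm[OF adj_op_iterate(1)[OF assms]] adj_op_iterate(2)[OF assms]])
  then show "norm ((T ^^ k) f v / z ^ Suc k) \<le> l ^ k * ell2_norm V f / cmod z ^ Suc k"
    by (simp add: norm_divide norm_power norm_mult divide_right_mono)
qed

text \<open>Minkowski's inequality bounds the partial sums by a geometric series; the bound passes
  to the limit because the norm over \<open>F\<close> is continuous in finitely many values.\<close>

lemma L2_set_resolvent_le:
  assumes f: "f \<in> ell2 V" and F: "finite F" "F \<subseteq> V"
  shows "L2_set (\<lambda>v. cmod (resolvent z f v)) F \<le> (\<Sum>k. l ^ k / cmod z ^ Suc k) * ell2_norm V f"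
proof (rule LIMSEQ_le_const2)
  let ?a = "\<lambda>k v. (T ^^ k) f v / z ^ Suc k"
  have "(\<lambda>n. \<Sum>k<n. ?a k v) \<longlonglongrightarrow> resolvent z f v" for v
    unfolding resolvent_def using resolvent_summable[OF f] by (rule summable_LIMSEQ)
  then show "(\<lambda>n. L2_set (\<lambda>v. cmod (\<Sum>k<n. ?a k v)) F) \<longlonglongrightarrow>
      L2_set (\<lambda>v. cmod (resolvent z f v)) F"
    unfolding L2_set_def by (intro tendsto_intros)
  have "L2_set (\<lambda>v. cmod (\<Sum>k<n. ?a k v)) F \<le> (\<Sum>k. l ^ k / cmod z ^ Suc k) * ell2_norm V f" for n
  proof -
    have "L2_set (\<lambda>v. cmod (\<Sum>k<n. ?a k v)) F \<le> (\<Sum>k<n. L2_set (\<lambda>v. cmod (?a k v)) F)"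
      by (rule L2_set_sum_le)
    also have "\<dots> \<le> (\<Sum>k<n. l ^ k / cmod z ^ Suc k * ell2_norm V f)"
    proof (rule sum_mono)
      fix k
      have "L2_set (\<lambda>v. cmod (?a k v)) F = L2_set (\<lambda>v. 1 / cmod z ^ Suc k * cmod ((T ^^ k) f v)) F"
        by (simp add: norm_divide norm_power norm_mult)
      also have "\<dots> = 1 / cmod z ^ Suc k * L2_set (\<lambda>v. cmod ((T ^^ k) f v)) F"
        by (rule L2_set_right_distrib[symmetric]) simp
      also have "\<dots> \<le> 1 / cmod z ^ Suc k * (l ^ k * ell2_norm V f)"
        using adj_op_iterate[OF f, of k] L2_set_le_ell2_norm[of "(T ^^ k) f" V F] F
        by (intro mult_left_mono) auto
      finally show "L2_set (\<lambda>v. cmod (?a k v)) F \<le> l ^ k / cmod z ^ Suc k * ell2_norm V f"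
        by simp
    qed
    also have "\<dots> = (\<Sum>k<n. l ^ k / cmod z ^ Suc k) * ell2_norm V f"
      by (simp add: sum_distrib_right)
    also have "\<dots> \<le> (\<Sum>k. l ^ k / cmod z ^ Suc k) * ell2_norm V f"
      using geometric_bound_summable[of 1] l_nonneg
      by (intro mult_right_mono sum_le_suminf ell2_norm_nonneg) auto
    finally show ?thesis .
  qed
  then show "\<exists>N. \<forall>n\<ge>N. L2_set (\<lambda>v. cmod (\<Sum>k<n. ?a k v)) F \<le>
      (\<Sum>k. l ^ k / cmod z ^ Suc k) * ell2_norm V f"
    by blast
qed

lemma iterate_add: "(T ^^ k) (\<lambda>v. f v + g v) = (\<lambda>v. (T ^^ k) f v + (T ^^ k) g v)"
  by (induction k) (simp_all add: adj_op_add)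

lemma iterate_scale: "(T ^^ k) (\<lambda>v. c * f v) = (\<lambda>v. c * (T ^^ k) f v)"
  by (induction k) (simp_all add: adj_op_scale)

lemma resolvent_outside: "f \<in> ell2 V \<Longrightarrow> v \<notin> V \<Longrightarrow> resolvent z f v = 0"
  by (simp add: resolvent_def ell2_outside[OF adj_op_iterate(1)])

lemma resolvent_add:
  "f \<in> ell2 V \<Longrightarrow> g \<in> ell2 V \<Longrightarrow>
    resolvent z (\<lambda>v. f v + g v) = (\<lambda>v. resolvent z f v + resolvent z g v)"
  unfolding resolvent_def iterate_add add_divide_distrib
  by (intro ext suminf_add[symmetric] resolvent_summable)

lemma resolvent_scale:
  "f \<in> ell2 V \<Longrightarrow> resolvent z (\<lambda>v. c * f v) = (\<lambda>v. c * resolvent z f v)"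
  unfolding resolvent_def iterate_scale times_divide_eq_right[symmetric]
  by (intro ext suminf_mult resolvent_summable)

lemma bounded_op_resolvent: "bounded_op V (resolvent z)"
  unfolding bounded_op_def
proof (intro conjI ballI allI exI)
  fix f assume f: "f \<in> ell2 V"
  show "resolvent z f \<in> ell2 V"
    and "ell2_norm V (resolvent z f) \<le> (\<Sum>k. l ^ k / cmod z ^ Suc k) * ell2_norm V f"
    by (rule ell2_boundI[OF resolvent_outside[OF f] L2_set_resolvent_le[OF f]]; assumption)+
qed (simp_all add: resolvent_add resolvent_scale)

text \<open>The series telescopes: its \<open>k\<close>-th term is \<open>?a k - ?a (Suc k)\<close>,
  and only \<open>?a 0 = f v\<close> survives.\<close>

lemma resolvent_left_inverse:
  assumes "f \<in> ell2 V"
  shows "resolvent z (\<lambda>v. z * f v - T f v) = f"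
proof
  fix v
  let ?a = "\<lambda>k. (T ^^ k) f v / z ^ k"
  have "(T ^^ k) (\<lambda>v. z * f v - T f v) v / z ^ Suc k = ?a k - ?a (Suc k)" for k
  proof -
    have "(\<lambda>v. z * f v - T f v) = (\<lambda>v. z * f v + (-1) * T f v)"
      by simp
    then have "(T ^^ k) (\<lambda>v. z * f v - T f v) v = z * (T ^^ k) f v - (T ^^ Suc k) f v"
      by (simp only: iterate_add iterate_scale) (simp add: funpow_swap1)
    then show ?thesis
      using z_nonzero by (simp add: diff_divide_distrib)
  qed
  \<comment> \<open>Up to the factor \<open>z\<close>, this is the general term of the convergent
    resolvent series of \<open>f\<close>.\<close>
  moreover have "?a \<longlonglongrightarrow> 0"
    using tendsto_mult[OF tendsto_const[of z] summable_LIMSEQ_zero[OF resolvent_summable[OF assms, of v]]]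
      z_nonzero by simp
  then have "(\<lambda>k. ?a k - ?a (Suc k)) sums (?a 0 - 0)"
    by (rule telescope_sums')
  ultimately show "resolvent z (\<lambda>v. z * f v - T f v) v = f v"
    unfolding resolvent_def by (simp add: sums_iff)
qed

text \<open>At each vertex \<open>T\<close> is a finite sum, so it passes through the series and
  commutes with the resolvent; this reduces the claim to the left inverse.\<close>

lemma resolvent_right_inverse:
  assumes "f \<in> ell2 V"
  shows "(\<lambda>v. z * resolvent z f v - T (resolvent z f) v) = f"
proof
  fix v
  have "T (resolvent z f) v = resolvent z (T f) v"
  proof (cases "v \<in> V")
    case True
    have "T (resolvent z f) v = (\<Sum>u\<in>nbhd G v. \<Sum>k. (T ^^ k) f u / z ^ Suc k)"
      using True by (simp add: adj_op_nbhd finite_nbhd resolvent_def)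
    also have "\<dots> = (\<Sum>k. \<Sum>u\<in>nbhd G v. (T ^^ k) f u / z ^ Suc k)"
      using resolvent_summable[OF assms] by (intro suminf_sum[symmetric])
    also have "\<dots> = resolvent z (T f) v"
      unfolding resolvent_def using True
      by (simp add: adj_op_nbhd finite_nbhd sum_divide_distrib funpow_swap1[symmetric])
    finally show ?thesis .
  next
    case False
    then show ?thesis
      using assms by (simp add: adj_op_outside resolvent_outside adj_op_ell2)
  qed
  then have "z * resolvent z f v - T (resolvent z f) v
      = resolvent z (\<lambda>v. z * f v + (-1) * T f v) v"
    by (simp only: resolvent_add[OF ell2_scale[OF assms] ell2_scale[OF adj_op_ell2[OF assms]]]
        resolvent_scale[OF assms] resolvent_scale[OF adj_op_ell2[OF assms]]) simp
  also have "\<dots> = f v"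
    using resolvent_left_inverse[OF assms] by simp
  finally show "z * resolvent z f v - T (resolvent z f) v = f v" .
qed

end

theorem op_spectrum_adj_op_subset: "op_spectrum V T \<subseteq> cball 0 l"
proof
  fix z assume "z \<in> op_spectrum V T"
  then have "\<not> l < cmod z"
    unfolding op_spectrum_def
    using bounded_op_resolvent resolvent_left_inverse resolvent_right_inverse by blast
  then show "z \<in> cball 0 l"
    by simp
qed

end

section \<open>2-token graphs\<close>

text \<open>A real supremum over the empty set carries no information, hence the nonemptiness
  assumption; for paths an explicit eigenvalue will provide it.\<close>

lemma spectral_radius_le:
  assumes "positive_supersolution G w l" "op_spectrum (verts G) (adj_op G) \<noteq> {}"
  shows "spectral_radius G \<le> l"
  using assms(2) positive_supersolution.op_spectrum_adj_op_subset[OF assms(1)]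
  unfolding spectral_radius_def by (intro cSUP_least) auto

lemma spectral_radius_eq:
  assumes "positive_supersolution G w l" "complex_of_real l \<in> op_spectrum (verts G) (adj_op G)"
  shows "spectral_radius G = l"
proof (rule antisym)
  show "spectral_radius G \<le> l"
    using assms by (intro spectral_radius_le) auto
  have "bdd_above (cmod ` op_spectrum (verts G) (adj_op G))"
    using positive_supersolution.op_spectrum_adj_op_subset[OF assms(1)]
    by (intro bdd_aboveI[of _ l]) auto
  then have "cmod (complex_of_real l) \<le> spectral_radius G"
    unfolding spectral_radius_def by (intro cSUP_upper assms(2))
  then show "l \<le> spectral_radius G"
    by simp
qed

section \<open>Structure of the 2-token graph\<close>

lemma verts_token2: "verts (token2 G) = {A. A \<subseteq> verts G \<and> card A = 2}"
  by (simp add: token2_def Let_def)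

lemma pair_in_verts_token2 [simp]:
  "{a, b} \<in> verts (token2 G) \<longleftrightarrow> a \<in> verts G \<and> b \<in> verts G \<and> a \<noteq> b"
  by (auto simp: verts_token2 card_insert_if)

lemma verts_token2_cases:
  assumes "A \<in> verts (token2 G)"
  obtains a b where "A = {a, b}" "a \<in> verts G" "b \<in> verts G" "a \<noteq> b"
  using assms by (auto simp: verts_token2 card_2_iff)

text \<open>An unordered pair \<open>{A, B}\<close> in the edge set may have been produced with
  \<open>A\<close> and \<open>B\<close> exchanged; symmetry of the condition restores the given
  order.\<close>

lemma edge_token2_iff:
  "{A, B} \<in> edges (token2 G) \<longleftrightarrow> A \<in> verts (token2 G) \<and> B \<in> verts (token2 G) \<and>
     (\<exists>a\<in>A. \<exists>b\<in>B. sym_diff A B = {a, b} \<and> {a, b} \<in> edges G)"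
proof -
  define P where "P A B \<longleftrightarrow> A \<in> verts (token2 G) \<and> B \<in> verts (token2 G) \<and>
     (\<exists>a\<in>A. \<exists>b\<in>B. sym_diff A B = {a, b} \<and> {a, b} \<in> edges G)" for A B
  have sym: "P B A" if P: "P A B" for A B
  proof -
    from P obtain a b where "a \<in> A" "b \<in> B" "sym_diff A B = {a, b}" "{a, b} \<in> edges G"
      unfolding P_def by blast
    then have "\<exists>b\<in>B. \<exists>a\<in>A. sym_diff B A = {b, a} \<and> {b, a} \<in> edges G"
      by (intro bexI[of _ b] bexI[of _ a]) (simp_all add: insert_commute Un_commute)
    with P show ?thesis
      by (simp add: P_def)
  qed
  have "{A, B} \<in> edges (token2 G) \<longleftrightarrow> (\<exists>A' B'. {A, B} = {A', B'} \<and> P A' B')"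
    by (simp add: P_def token2_def Let_def)
  also have "\<dots> \<longleftrightarrow> P A B"
    unfolding doubleton_eq_iff using sym by blast
  finally show ?thesis
    unfolding P_def .
qed

text \<open>The description is well defined for symmetric \<open>h\<close>. A singleton
  \<open>{a}\<close>, read as \<open>{a, a}\<close>, receives the diagonal value
  \<open>h a a\<close>.\<close>

definition pair_lift :: "('a \<Rightarrow> 'a \<Rightarrow> 'b) \<Rightarrow> 'a set \<Rightarrow> 'b" where
  "pair_lift h A = (THE c. \<exists>a b. A = {a, b} \<and> c = h a b)"

lemma pair_lift_eq:
  assumes "\<And>a b. h a b = h b a"
  shows "pair_lift h {a, b} = h a b"
  unfolding pair_lift_def using assms by (intro the_equality) (auto simp: doubleton_eq_iff)

locale locally_finite_graph =
  fixes G :: "'a ugraph"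
  assumes finite_nbhd: "v \<in> verts G \<Longrightarrow> finite (nbhd G v)"
    and loopfree: "v \<notin> nbhd G v"
begin

text \<open>One token moves along an edge and the other stays; the removed vertex is the occupied
  one.\<close>

lemma nbhd_token2:
  assumes ab: "a \<in> verts G" "b \<in> verts G" "a \<noteq> b"
  shows "nbhd (token2 G) {a, b} =
    (\<lambda>a'. {a', b}) ` (nbhd G a - {b}) \<union> (\<lambda>b'. {a, b'}) ` (nbhd G b - {a})"
proof (intro equalityI subsetI)
  \<comment> \<open>Here the token on \<open>a\<close> moves; exchanging \<open>a\<close> and
    \<open>b\<close> gives the other case.\<close>
  have step: "B = {y, b} \<and> y \<in> nbhd G a - {b}"
    if "B \<in> verts (token2 G)" "a \<in> verts G" "a \<noteq> b" "y \<in> B"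
      "sym_diff {a, b} B = {a, y}" "{a, y} \<in> edges G" for a b y B
  proof -
    have y: "y \<in> verts G" "card B = 2"
      using that by (auto simp: verts_token2)
    have "y \<in> sym_diff {a, b} B"
      unfolding that(5) by simp
    then have "y \<notin> {a, b}"
      using \<open>y \<in> B\<close> by blast
    then have "b \<notin> sym_diff {a, b} B"
      unfolding that(5) using \<open>a \<noteq> b\<close> by blast
    then have "b \<in> B"
      by blast
    have "finite B"
      using y(2) by (intro card_ge_0_finite) simp
    then have "{y, b} = B"
      using y(2) \<open>y \<in> B\<close> \<open>b \<in> B\<close> \<open>y \<notin> {a, b}\<close> by (intro card_subset_eq) auto
    moreover have "y \<in> nbhd G a - {b}"
      using that(6) y(1) \<open>y \<notin> {a, b}\<close> by (simp add: nbhd_def)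
    ultimately show ?thesis
      by blast
  qed
  fix B assume "B \<in> nbhd (token2 G) {a, b}"
  then obtain x y where B: "B \<in> verts (token2 G)" "x \<in> {a, b}" "y \<in> B"
      "sym_diff {a, b} B = {x, y}" "{x, y} \<in> edges G"
    by (auto simp: nbhd_def edge_token2_iff)
  then consider "x = a" | "x = b"
    by blast
  then show "B \<in> (\<lambda>a'. {a', b}) ` (nbhd G a - {b}) \<union> (\<lambda>b'. {a, b'}) ` (nbhd G b - {a})"
  proof cases
    case 1
    then have "B = {y, b} \<and> y \<in> nbhd G a - {b}"
      using B ab by (intro step) simp_all
    then show ?thesis
      by blast
  next
    case 2
    then have "B = {y, a} \<and> y \<in> nbhd G b - {a}"
      using B ab by (intro step) (simp_all add: insert_commute)
    then show ?thesis
      by blast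
  qed
next
  have step: "{a', b} \<in> nbhd (token2 G) {a, b}"
    if "a' \<in> nbhd G a - {b}" "a \<in> verts G" "b \<in> verts G" "a \<noteq> b" for a b a'
  proof -
    have "a' \<noteq> a"
      using that loopfree[of a] by auto
    then have "sym_diff {a, b} {a', b} = {a, a'}"
      using that by blast
    moreover have "a' \<in> verts G" "a' \<noteq> b" "{a, a'} \<in> edges G"
      using that(1) by (simp_all add: nbhd_def)
    ultimately have "\<exists>x\<in>{a, b}. \<exists>y\<in>{a', b}. sym_diff {a, b} {a', b} = {x, y} \<and> {x, y} \<in> edges G"
      by blast
    with that \<open>a' \<in> verts G\<close> show ?thesis
      by (simp add: nbhd_def[of "token2 G"] edge_token2_iff)
  qed
  fix B assume "B \<in> (\<lambda>a'. {a', b}) ` (nbhd G a - {b}) \<union> (\<lambda>b'. {a, b'}) ` (nbhd G b - {a})"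
  then show "B \<in> nbhd (token2 G) {a, b}"
  proof
    assume "B \<in> (\<lambda>a'. {a', b}) ` (nbhd G a - {b})"
    then show ?thesis
      using step[of _ a b] ab by blast
  next
    assume "B \<in> (\<lambda>b'. {a, b'}) ` (nbhd G b - {a})"
    then obtain b' where "B = {b', a}" "b' \<in> nbhd G b - {a}"
      by blast
    then show ?thesis
      using step[of b' b a] ab by (simp add: insert_commute)
  qed
qed

lemma finite_nbhd_token2:
  assumes "A \<in> verts (token2 G)"
  shows "finite (nbhd (token2 G) A)"
  using assms by (elim verts_token2_cases) (simp add: nbhd_token2 finite_nbhd)

text \<open>As \<open>f\<close> vanishes on singletons, the forbidden move onto the occupied vertex
  can be added back with value 0, so each sum runs over a full neighbourhood.\<close>

lemma sum_nbhd_token2: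
  fixes f :: "'a set \<Rightarrow> 'b::comm_monoid_add"
  assumes ab: "a \<in> verts G" "b \<in> verts G" "a \<noteq> b" and f: "f {a} = 0" "f {b} = 0"
  shows "(\<Sum>B\<in>nbhd (token2 G) {a, b}. f B) =
    (\<Sum>a'\<in>nbhd G a. f {a', b}) + (\<Sum>b'\<in>nbhd G b. f {a, b'})"
proof -
  let ?I = "(\<lambda>a'. {a', b}) ` (nbhd G a - {b})" and ?J = "(\<lambda>b'. {a, b'}) ` (nbhd G b - {a})"
  \<comment> \<open>For \<open>a \<noteq> b\<close>, equality of \<open>{a', b}\<close> and
    \<open>{a, b'}\<close> forces \<open>a' = a\<close>, which loop-freeness excludes.\<close>
  have "?I \<inter> ?J = {}"
    using ab loopfree[of a] by (auto simp: doubleton_eq_iff)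
  then have "(\<Sum>B\<in>nbhd (token2 G) {a, b}. f B) = sum f ?I + sum f ?J"
    using ab by (simp add: nbhd_token2 finite_nbhd sum.union_disjoint)
  also have "sum f ?I = (\<Sum>a'\<in>nbhd G a - {b}. f {a', b})"
    by (subst sum.reindex) (auto simp: inj_on_def doubleton_eq_iff)
  also have "\<dots> = (\<Sum>a'\<in>nbhd G a. f {a', b})"
    using ab f by (intro sum.mono_neutral_left) (auto simp: finite_nbhd)
  also have "sum f ?J = (\<Sum>b'\<in>nbhd G b - {a}. f {a, b'})"
    by (subst sum.reindex) (auto simp: inj_on_def doubleton_eq_iff)
  also have "\<dots> = (\<Sum>b'\<in>nbhd G b. f {a, b'})"
    using ab f by (intro sum.mono_neutral_left) (auto simp: finite_nbhd)
  finally show ?thesis .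
qed

text \<open>The zero diagonal makes the lift vanish on singletons, so \<open>super\<close> becomes
  the supersolution inequality on the token graph.\<close>

lemma token2_positive_supersolution:
  assumes sym: "\<And>a b. h a b = h b a" and diag: "\<And>a. h a a = 0"
    and pos: "\<And>a b. a \<in> verts G \<Longrightarrow> b \<in> verts G \<Longrightarrow> a \<noteq> b \<Longrightarrow> 0 < h a b"
    and super: "\<And>a b. a \<in> verts G \<Longrightarrow> b \<in> verts G \<Longrightarrow> a \<noteq> b \<Longrightarrow>
      (\<Sum>a'\<in>nbhd G a. h a' b) + (\<Sum>b'\<in>nbhd G b. h a b') \<le> l * h a b"
    and l: "0 \<le> l"
  shows "positive_supersolution (token2 G) (pair_lift h) l"
proof
  note lift = pair_lift_eq[of h, OF sym]
  have single: "pair_lift h {a} = 0" for a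
    using lift[of a a] diag[of a] by simp
  fix A assume A: "A \<in> verts (token2 G)"
  then show "finite (nbhd (token2 G) A)"
    by (rule finite_nbhd_token2)
  from A obtain a b where "A = {a, b}" "a \<in> verts G" "b \<in> verts G" "a \<noteq> b"
    by (rule verts_token2_cases)
  then show "0 < pair_lift h A" "(\<Sum>B\<in>nbhd (token2 G) A. pair_lift h B) \<le> l * pair_lift h A"
    using pos super by (simp_all add: sum_nbhd_token2 single lift)
qed (rule l)

lemma adj_op_token2:
  assumes "a \<in> verts G" "b \<in> verts G" "a \<noteq> b" "\<And>c. f {c} = 0"
  shows "adj_op (token2 G) f {a, b} = (\<Sum>a'\<in>nbhd G a. f {a', b}) + (\<Sum>b'\<in>nbhd G b. f {a, b'})"
  using assms by (simp add: adj_op_nbhd finite_nbhd_token2 sum_nbhd_token2)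

lemma token2_eigenvalue:
  fixes l :: real
  assumes sym: "\<And>a b. h a b = h b a" and diag: "\<And>a. h a a = 0" and fin: "finite (verts G)"
    and eigen: "\<And>a b. a \<in> verts G \<Longrightarrow> b \<in> verts G \<Longrightarrow> a \<noteq> b \<Longrightarrow>
      (\<Sum>a'\<in>nbhd G a. h a' b) + (\<Sum>b'\<in>nbhd G b. h a b') = l * h a b"
    and nonzero: "x \<in> verts G" "y \<in> verts G" "h x y \<noteq> 0"
  shows "complex_of_real l \<in> op_spectrum (verts (token2 G)) (adj_op (token2 G))"
proof (rule eigenvalue_in_op_spectrum)
  let ?V = "verts (token2 G)"
  define f where "f A = (if A \<in> ?V then complex_of_real (pair_lift h A) else 0)" for A
  have f_pair: "f {a, b} = complex_of_real (h a b)" if "a \<in> verts G" "b \<in> verts G" for a b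
    using that diag by (auto simp: f_def pair_lift_eq sym)
  have f_single: "f {c} = 0" for c
    by (simp add: f_def verts_token2)
  have "finite ?V"
    using fin by (simp add: verts_token2)
  then show "f \<in> ell2 ?V"
    by (rule ell2_finite_support) (auto simp: f_def)
  show "adj_op (token2 G) f = (\<lambda>v. complex_of_real l * f v)"
  proof
    fix A show "adj_op (token2 G) f A = complex_of_real l * f A"
    proof (cases "A \<in> ?V")
      case True
      then obtain a b where A: "A = {a, b}" and ab: "a \<in> verts G" "b \<in> verts G" "a \<noteq> b"
        by (rule verts_token2_cases)
      have "adj_op (token2 G) f A = (\<Sum>a'\<in>nbhd G a. f {a', b}) + (\<Sum>b'\<in>nbhd G b. f {a, b'})"
        unfolding A using ab f_single by (rule adj_op_token2)
      also have "\<dots> = complex_of_real ((\<Sum>a'\<in>nbhd G a. h a' b) + (\<Sum>b'\<in>nbhd G b. h a b'))"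
        using ab by (auto simp: f_pair nbhd_def)
      also have "\<dots> = complex_of_real l * f A"
        unfolding A f_pair[OF ab(1,2)] eigen[OF ab] by simp
      finally show ?thesis .
    qed (simp add: adj_op_outside f_def)
  qed
  show "f {x, y} \<noteq> 0"
    using nonzero by (simp add: f_pair)
qed

end

section \<open>Infinite paths and cycles\<close>

context locally_finite_graph
begin

text \<open>Each of the two tokens has at most two moves, and the weight is constantly 1 on
  2-subsets.\<close>

lemma token2_four_supersolution:
  assumes "\<And>v. v \<in> verts G \<Longrightarrow> card (nbhd G v) \<le> 2"
  shows "positive_supersolution (token2 G) (pair_lift (\<lambda>a b. of_bool (a \<noteq> b))) 4"
proof (rule token2_positive_supersolution)
  fix a b assume ab: "a \<in> verts G" "b \<in> verts G" "a \<noteq> b"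
  have bound: "(\<Sum>x\<in>nbhd G v. of_bool (P x)) \<le> (2::real)" if "v \<in> verts G" for v and P :: "'a \<Rightarrow> bool"
  proof -
    have "(\<Sum>x\<in>nbhd G v. of_bool (P x)) \<le> (\<Sum>x\<in>nbhd G v. 1::real)"
      by (intro sum_mono) simp
    then show ?thesis
      using assms[OF that] by simp
  qed
  show "(\<Sum>a'\<in>nbhd G a. of_bool (a' \<noteq> b)) + (\<Sum>b'\<in>nbhd G b. of_bool (a \<noteq> b')) \<le> 4 * (of_bool (a \<noteq> b) :: real)"
    using bound[OF ab(1), of "\<lambda>a'. a' \<noteq> b"] bound[OF ab(2), of "\<lambda>b'. a \<noteq> b'"] ab(3) by simp
qed auto

text \<open>The approximate eigenfunctions are indicators of square boxes of pairs far from the diagonal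
  and from the end of the ray: \<open>4 f - A f\<close> lives near the boundary of the box.\<close>

lemma four_in_spectrum_token2:
  fixes e :: "nat \<Rightarrow> 'a"
  assumes inj: "inj e" and e: "\<And>k. e k \<in> verts G"
    and nbhd: "\<And>k. nbhd G (e (Suc k)) = {e k, e (Suc (Suc k))}"
  shows "4 \<in> op_spectrum (verts (token2 G)) (adj_op (token2 G))"
proof (rule approximate_eigenvalue_in_op_spectrum)
  let ?V = "verts (token2 G)" and ?T = "adj_op (token2 G)"
  fix C :: real
  \<comment> \<open>The constant is \<open>64 * 8\<close>: below, \<open>g\<close> has modulus at
    most 8 and lives on a frame of
    \<open>(2 * N + 3)\<^sup>2 - (2 * N - 1)\<^sup>2 = 8 * (2 * N + 1)\<close> pairs, while
    \<open>f\<close> has squared norm \<open>(2 * N + 1)\<^sup>2\<close>.\<close>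
  obtain N0 :: nat where "512 * C\<^sup>2 < real N0"
    using reals_Archimedean2 by blast
  define N where "N = Suc N0"
  have N: "512 * C\<^sup>2 < 2 * real N + 1" "1 \<le> N"
    using \<open>512 * C\<^sup>2 < real N0\<close> by (simp_all add: N_def)
  \<comment> \<open>For \<open>r \<le> N + 1 \<le> 2 * N\<close> the first coordinate stays between
    \<open>8 * N\<close> and \<open>12 * N\<close> and the second is at least \<open>18 * N\<close>,
    so the box avoids 0 and the diagonal.\<close>
  define I where "I r = {10 * N - r..10 * N + r} \<times> {20 * N - r..20 * N + r}" for r
  have I_iff: "(i, j) \<in> I r \<longleftrightarrow> 10 * N \<le> i + r \<and> i \<le> 10 * N + r \<and> 20 * N \<le> j + r \<and> j \<le> 20 * N + r"
    for i j r
    by (auto simp: I_def le_diff_conv)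
  define Q where "Q r = (\<lambda>(i, j). {e i, e j}) ` I r" for r
  have eq: "{e i, e j} = {e i', e j'} \<longleftrightarrow> i = i' \<and> j = j' \<or> i = j' \<and> j = i'" for i j i' j'
    by (auto simp: doubleton_eq_iff inj_eq[OF inj])
  have Q_iff: "{e i, e j} \<in> Q r \<longleftrightarrow> (i, j) \<in> I r \<or> (j, i) \<in> I r" for i j r
    by (auto simp: Q_def eq image_iff)
  have fin: "finite (Q r)" for r
    by (simp add: Q_def I_def)
  have card_Q: "card (Q r) = (2 * r + 1)\<^sup>2" if "r \<le> N + 1" for r
  proof -
    have "inj_on (\<lambda>(i, j). {e i, e j}) (I r)"
      using that N(2) by (auto simp: inj_on_def eq I_iff)
    then have "card (Q r) = card (I r)"
      unfolding Q_def by (rule card_image)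
    also have "\<dots> = (2 * r + 1)\<^sup>2"
      using that N(2) by (simp add: I_def power2_eq_square)
    finally show ?thesis .
  qed
  have Q_mono: "Q r \<subseteq> Q s" if "r \<le> s" for r s
    using that unfolding Q_def by (intro image_mono) (auto simp: I_iff)
  \<comment> \<open>Indices are written as successors because the neighbourhood of
    \<open>e k\<close> is given only for positive \<open>k\<close>.\<close>
  have Q_cases: "\<exists>i j. A = {e (Suc i), e (Suc j)} \<and> (Suc i, Suc j) \<in> I r \<and> i \<noteq> j"
    if "A \<in> Q r" "r \<le> N + 1" for A r
  proof -
    obtain i j where ij: "A = {e i, e j}" "(i, j) \<in> I r"
      using \<open>A \<in> Q r\<close> by (auto simp: Q_def)
    then have "0 < i" "0 < j" "i \<noteq> j"
      using that N(2) by (auto simp: I_iff)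
    with ij show ?thesis
      by (intro exI[of _ "i - 1"] exI[of _ "j - 1"]) auto
  qed
  have Q_verts: "Q r \<subseteq> ?V" if "r \<le> N + 1" for r
  proof
    fix A assume "A \<in> Q r"
    from Q_cases[OF this that] show "A \<in> ?V"
      using e by (auto simp: inj_eq[OF inj])
  qed
  have nbhd_pair: "nbhd (token2 G) {e (Suc i), e (Suc j)} \<subseteq>
      {{e i, e (Suc j)}, {e (i + 2), e (Suc j)}, {e (Suc i), e j}, {e (Suc i), e (j + 2)}}"
    if "i \<noteq> j" for i j
    using that e by (subst nbhd_token2) (auto simp: nbhd inj_eq[OF inj])
  have Q_nbhd: "B \<in> Q (Suc r)" if A: "A \<in> Q r" and B: "B \<in> nbhd (token2 G) A" and r: "r \<le> N" for A B r
  proof -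
    have "r \<le> N + 1"
      using r by simp
    with A obtain i j where ij: "A = {e (Suc i), e (Suc j)}" "(Suc i, Suc j) \<in> I r" "i \<noteq> j"
      using Q_cases by blast
    have "(i, Suc j) \<in> I (Suc r)" "(i + 2, Suc j) \<in> I (Suc r)"
      "(Suc i, j) \<in> I (Suc r)" "(Suc i, j + 2) \<in> I (Suc r)"
      using ij(2) r N(2) by (auto simp: I_iff)
    then show ?thesis
      using nbhd_pair[OF ij(3)] B unfolding ij(1) by (auto simp: Q_iff)
  qed
  define f :: "'a set \<Rightarrow> complex" where "f A = of_bool (A \<in> Q N)" for A
  define g where "g A = 4 * f A - ?T f A" for A
  have single: "f {c} = 0" for c
    using Q_verts[of N] by (auto simp: f_def verts_token2)
  have Tf: "?T f {e (Suc i), e (Suc j)} =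
      f {e i, e (Suc j)} + f {e (i + 2), e (Suc j)} + f {e (Suc i), e j} + f {e (Suc i), e (j + 2)}"
    if "i \<noteq> j" for i j
    using that e single by (simp add: adj_op_token2 inj_eq[OF inj] nbhd)
  have g_outside: "g A = 0" if "A \<notin> Q (Suc N)" for A
  proof -
    have "f A = 0"
      using that Q_mono[of N "Suc N"] by (auto simp: f_def)
    moreover have "?T f A = 0"
    proof (cases "A \<in> ?V")
      case True
      have "f B = 0" if "B \<in> nbhd (token2 G) A" for B
        using that True Q_nbhd[of B N A] nbhd_sym[OF that True] \<open>A \<notin> Q (Suc N)\<close>
        by (auto simp: f_def)
      with True show ?thesis
        by (simp add: adj_op_nbhd finite_nbhd_token2)
    qed (simp add: adj_op_outside)
    ultimately show ?thesis
      by (simp add: g_def)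
  qed
  \<comment> \<open>Such a pair and its four neighbours all lie in \<open>Q N\<close>, so
    \<open>g\<close> is \<open>4 - 4\<close> there.\<close>
  have g_inside: "g A = 0" if A: "A \<in> Q (N - 1)" for A
  proof -
    have "N - 1 \<le> N + 1"
      by simp
    with A obtain i j where ij: "A = {e (Suc i), e (Suc j)}" "(Suc i, Suc j) \<in> I (N - 1)" "i \<noteq> j"
      using Q_cases by blast
    have "(Suc i, Suc j) \<in> I N" "(i, Suc j) \<in> I N" "(i + 2, Suc j) \<in> I N"
      "(Suc i, j) \<in> I N" "(Suc i, j + 2) \<in> I N"
      using ij(2) by (simp_all add: I_iff N_def)
    then show ?thesis
      unfolding ij(1) g_def Tf[OF ij(3)] by (simp add: f_def Q_iff)
  qed
  have g_bound: "cmod (g A) \<le> 8" if A: "A \<in> Q (Suc N)" for A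
  proof -
    obtain i j where ij: "A = {e (Suc i), e (Suc j)}" "i \<noteq> j"
      using Q_cases[OF A] by auto
    have one: "cmod (f B) \<le> 1" for B
      by (simp add: f_def)
    have "cmod (g A) \<le> cmod (4 * f A) + cmod (?T f A)"
      unfolding g_def by (rule norm_triangle_ineq4)
    also have "\<dots> \<le> 4 * 1 + (1 + 1 + 1 + 1)"
      unfolding ij(1) Tf[OF ij(2)]
      by (intro add_mono order_trans[OF norm_triangle_ineq] one) (simp add: norm_mult one)
    finally show ?thesis
      by simp
  qed
  have norm_f: "ell2_norm ?V f = 2 * N + 1" and f: "f \<in> ell2 ?V"
  proof -
    have "ell2_norm ?V f = L2_set (\<lambda>v. cmod (f v)) (Q N)"
      using fin Q_verts by (intro ell2_finite_support) (auto simp: f_def)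
    also have "\<dots> = sqrt (real (card (Q N)))"
      unfolding L2_set_def by (simp add: f_def)
    finally show "ell2_norm ?V f = 2 * N + 1"
      by (simp add: card_Q)
    show "f \<in> ell2 ?V"
      using fin Q_verts by (intro ell2_finite_support[of "Q N"]) (auto simp: f_def)
  qed
  have g: "g \<in> ell2 ?V" and norm_g: "(ell2_norm ?V g)\<^sup>2 \<le> 512 * (2 * N + 1)"
  proof -
    show "g \<in> ell2 ?V"
      using fin Q_verts g_outside by (intro ell2_finite_support[of "Q (Suc N)"]) auto
    have "ell2_norm ?V g = L2_set (\<lambda>v. cmod (g v)) (Q (Suc N))"
      using fin Q_verts g_outside by (intro ell2_finite_support) auto
    then have "(ell2_norm ?V g)\<^sup>2 = (\<Sum>A\<in>Q (Suc N). (cmod (g A))\<^sup>2)"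
      by (simp add: L2_set_def sum_nonneg)
    also have "\<dots> = (\<Sum>A\<in>Q (Suc N) - Q (N - 1). (cmod (g A))\<^sup>2)"
      using fin g_inside by (intro sum.mono_neutral_right) auto
    also have "\<dots> \<le> (\<Sum>A\<in>Q (Suc N) - Q (N - 1). 8\<^sup>2)"
      using g_bound by (intro sum_mono power_mono) auto
    also have "\<dots> = 64 * (real (card (Q (Suc N))) - real (card (Q (N - 1))))"
      using fin Q_mono[of "N - 1" "Suc N"]
      by (simp add: card_Diff_subset of_nat_diff card_mono)
    also have "\<dots> = 512 * (2 * N + 1)"
      using N(2) by (simp add: card_Q N_def power2_eq_square algebra_simps)
    finally show "(ell2_norm ?V g)\<^sup>2 \<le> 512 * (2 * N + 1)"
      by simp
  qed
  have "(C * ell2_norm ?V g)\<^sup>2 \<le> C\<^sup>2 * (512 * (2 * N + 1))"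
    using norm_g by (simp add: power_mult_distrib mult_left_mono)
  also have "\<dots> = 512 * C\<^sup>2 * (2 * N + 1)"
    by simp
  also have "\<dots> < (2 * real N + 1) * (2 * N + 1)"
    using N(1) by (intro mult_strict_right_mono) auto
  also have "\<dots> = (ell2_norm ?V f)\<^sup>2"
    by (simp add: norm_f power2_eq_square)
  finally have "C * ell2_norm ?V g < ell2_norm ?V f"
    using ell2_norm_nonneg by (rule power_less_imp_less_base)
  with f g show "\<exists>f\<in>ell2 ?V. (\<lambda>v. 4 * f v - ?T f v) \<in> ell2 ?V \<and>
      C * ell2_norm ?V (\<lambda>v. 4 * f v - ?T f v) < ell2_norm ?V f"
    unfolding g_def by blast
qed

lemma token2_spectral_radius_four:
  assumes "inj e" "\<And>k. e k \<in> verts G" "\<And>k. nbhd G (e (Suc k)) = {e k, e (Suc (Suc k))}"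
    and "\<And>v. v \<in> verts G \<Longrightarrow> card (nbhd G v) \<le> 2"
  shows "spectral_radius (token2 G) = 4"
proof (rule spectral_radius_eq)
  show "positive_supersolution (token2 G) (pair_lift (\<lambda>a b. of_bool (a \<noteq> b))) 4"
    using assms(4) by (rule token2_four_supersolution)
  show "complex_of_real 4 \<in> op_spectrum (verts (token2 G)) (adj_op (token2 G))"
    using four_in_spectrum_token2[OF assms(1,2,3)] by simp
qed

end

section \<open>The ray and the two-way infinite path\<close>

lemma nbhd_inf_path_graph: "nbhd inf_path_graph i = {j. j = i + 1 \<or> i = j + 1}"
  by (simp add: nbhd_def inf_path_graph_def doubleton_eq_iff ex_disj_distrib)

lemma nbhd_inf_cycle_graph: "nbhd inf_cycle_graph i = {i + 1, i - 1}"
proof -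
  have "nbhd inf_cycle_graph i = {j. j = i + 1 \<or> i = j + 1}"
    by (simp add: nbhd_def inf_cycle_graph_def doubleton_eq_iff ex_disj_distrib)
  also have "\<dots> = {i + 1, i - 1}"
    by (rule set_eqI) (simp add: eq_diff_eq eq_commute[of i])
  finally show ?thesis .
qed

lemma inf_path_token2_spectral_radius: "spectral_radius (token2 inf_path_graph) = 4"
proof -
  \<comment> \<open>At \<open>i = 0\<close> truncated subtraction puts the non-neighbour 0 into the
    right-hand set, so only an inclusion holds.\<close>
  have sub: "nbhd inf_path_graph i \<subseteq> {i + 1, i - 1}" for i
    by (auto simp: nbhd_inf_path_graph)
  interpret locally_finite_graph inf_path_graph
  proof
    show "finite (nbhd inf_path_graph i)" for i
      using sub by (rule finite_subset) simp
  qed (simp add: nbhd_inf_path_graph)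
  show ?thesis
  proof (rule token2_spectral_radius_four)
    show "inj (id :: nat \<Rightarrow> nat)"
      by simp
    show "id k \<in> verts inf_path_graph" for k
      by (simp add: inf_path_graph_def)
    show "nbhd inf_path_graph (id (Suc k)) = {id k, id (Suc (Suc k))}" for k
      by (auto simp: nbhd_inf_path_graph)
    fix i
    have "card (nbhd inf_path_graph i) \<le> card {i + 1, i - 1}"
      using sub by (intro card_mono) auto
    also have "\<dots> \<le> 2"
      by (simp add: card_insert_if)
    finally show "card (nbhd inf_path_graph i) \<le> 2" .
  qed
qed

lemma inf_cycle_token2_spectral_radius: "spectral_radius (token2 inf_cycle_graph) = 4"
proof -
  interpret locally_finite_graph inf_cycle_graph
    by standard (simp_all add: nbhd_inf_cycle_graph)
  show ?thesis
  proof (rule token2_spectral_radius_four)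
    \<comment> \<open>The nonnegative ray inside the two-way path has room for all the
      boxes.\<close>
    show "inj int"
      by simp
    show "int k \<in> verts inf_cycle_graph" for k
      by (simp add: inf_cycle_graph_def)
    show "nbhd inf_cycle_graph (int (Suc k)) = {int k, int (Suc (Suc k))}" for k
      by (auto simp: nbhd_inf_cycle_graph)
    show "card (nbhd inf_cycle_graph i) \<le> 2" for i
      by (simp add: nbhd_inf_cycle_graph card_insert_if)
  qed
qed

section \<open>Paths and cycles\<close>

lemma path_edge_iff: "{i, j} \<in> edges (path_graph n) \<longleftrightarrow> i < n \<and> j < n \<and> (j = i + 1 \<or> i = j + 1)"
  by (auto simp: path_graph_def doubleton_eq_iff)

lemma nbhd_path_graph:
  "nbhd (path_graph n) i = (if i < n then {j. j < n \<and> (j = i + 1 \<or> i = j + 1)} else {})"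
  by (auto simp: nbhd_def path_edge_iff) (simp_all add: path_graph_def)

lemma sum_nbhd_path_graph:
  fixes f :: "nat \<Rightarrow> real"
  assumes "i < n"
  shows "(\<Sum>j\<in>nbhd (path_graph n) i. f j) =
    (if i + 1 < n then f (i + 1) else 0) + (if i = 0 then 0 else f (i - 1))"
proof -
  have "nbhd (path_graph n) i = (if i + 1 < n then {i + 1} else {}) \<union> (if i = 0 then {} else {i - 1})"
    using assms by (auto simp: nbhd_path_graph)
  then show ?thesis
    by (auto simp: sum.union_disjoint)
qed

lemma locally_finite_path_graph: "locally_finite_graph (path_graph n)"
  by standard (auto simp: nbhd_path_graph)

lemma nbhd_cycle_graph:
  assumes "n \<ge> 3"
  shows "nbhd (cycle_graph n) i =
    (if i < n then {if i + 1 = n then 0 else i + 1, if i = 0 then n - 1 else i - 1} else {})"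
proof -
  \<comment> \<open>Cyclic successor \<open>s\<close> and predecessor \<open>p\<close>, with the
    wrap-around written out so that \<open>mod\<close> disappears.\<close>
  define s where "s k = (if k + 1 = n then 0 else k + 1)" for k
  define p where "p = (if i = 0 then n - 1 else i - 1)"
  have s_mod: "Suc k mod n = s k" if "k < n" for k
    using that by (simp add: s_def)
  have s_less: "s k < n" if "k < n" for k
    using that assms by (simp add: s_def)
  have edge: "{i, j} \<in> edges (cycle_graph n) \<longleftrightarrow> (i < n \<and> j = s i) \<or> (j < n \<and> i = s j)" for j
  proof -
    have "{i, j} \<in> edges (cycle_graph n) \<longleftrightarrow> (\<exists>k. {i, j} = {k, s k} \<and> k < n)"
      by (simp add: cycle_graph_def s_mod cong: rev_conj_cong)
    then show ?thesis
      unfolding doubleton_eq_iff by auto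
  qed
  have p_less: "p < n" if "i < n"
    using that by (auto simp: p_def)
  have pred: "i = s j \<longleftrightarrow> j = p" if "i < n" "j < n" for j
    unfolding s_def p_def using that assms by (cases "i = 0"; cases "j + 1 = n") auto
  have "nbhd (cycle_graph n) i = (if i < n then {j. j < n \<and> (j = s i \<or> i = s j)} else {})"
    using s_less unfolding nbhd_def edge by (auto simp: cycle_graph_def)
  also have "\<dots> = (if i < n then {j. j < n \<and> (j = s i \<or> j = p)} else {})"
    using pred by (simp cong: conj_cong)
  also have "\<dots> = (if i < n then {s i, p} else {})"
    by (auto simp: s_less p_less)
  finally show ?thesis
    unfolding s_def p_def .
qed

lemma locally_finite_cycle_graph: "n \<ge> 3 \<Longrightarrow> locally_finite_graph (cycle_graph n)"
  by standard (auto simp: nbhd_cycle_graph split: if_splits)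

text \<open>For \<open>n > 0\<close> this is half the distance between the \<open>i\<close>-th and
  \<open>j\<close>-th of the \<open>n\<close>-th roots of unity, hence symmetric and periodic modulo
  \<open>n\<close> in each index.\<close>

definition sine_weight :: "nat \<Rightarrow> nat \<Rightarrow> nat \<Rightarrow> real" where
  "sine_weight n i j = \<bar>sin (pi * (real i - real j) / n)\<bar>"

lemma sine_weight_sym: "sine_weight n i j = sine_weight n j i"
proof -
  have "pi * (real i - real j) / n = - (pi * (real j - real i) / n)"
    by (metis minus_diff_eq minus_divide_left mult_minus_right)
  then show ?thesis
    unfolding sine_weight_def by simp
qed

lemma sine_weight_diag: "sine_weight n i i = 0"
  by (simp add: sine_weight_def)

lemma sine_weight_pos:
  assumes "i < n" "j < n" "i \<noteq> j"
  shows "0 < sine_weight n i j"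
proof -
  have *: "0 < sine_weight n i j" if "i < n" "j < i" for i j
  proof -
    have "0 < sin (pi * (real i - real j) / n)"
      using that by (intro sin_gt_zero) (auto simp: divide_less_eq)
    then show ?thesis
      by (simp add: sine_weight_def)
  qed
  show ?thesis
    using assms *[of i j] *[of j i] sine_weight_sym[of n i j] by (cases i j rule: linorder_cases) auto
qed

lemma sine_recurrence: "sin (a + t) + sin (a - t) = 2 * cos t * sin (a::real)"
  by (simp add: sin_add sin_diff)

text \<open>For \<open>1 \<le> x \<le> n - 1\<close> the points \<open>x - 1\<close>,
  \<open>x\<close>, \<open>x + 1\<close> lie between 0 and \<open>n\<close>, where
  \<open>sin (pi * x / n)\<close> is nonnegative, so the absolute values drop out and
  \<open>sine_recurrence\<close> applies. Negative \<open>x\<close> follows by reflection.\<close>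

lemma abs_sine_recurrence:
  assumes "1 \<le> \<bar>x\<bar>" "\<bar>x\<bar> \<le> real n - 1"
  shows "\<bar>sin (pi * (x + 1) / n)\<bar> + \<bar>sin (pi * (x - 1) / n)\<bar> = 2 * cos (pi / n) * \<bar>sin (pi * x / n)\<bar>"
proof -
  have split: "pi * (y + 1) / n = pi * y / n + pi / n" "pi * (y - 1) / n = pi * y / n - pi / n" for y
    by (simp_all add: distrib_left right_diff_distrib add_divide_distrib diff_divide_distrib)
  have positive: "\<bar>sin (pi * (y + 1) / n)\<bar> + \<bar>sin (pi * (y - 1) / n)\<bar> = 2 * cos (pi / n) * \<bar>sin (pi * y / n)\<bar>"
    if "1 \<le> y" "y \<le> real n - 1" for y
  proof -
    have nonneg: "0 \<le> sin (pi * z / n)" if "0 \<le> z" "z \<le> real n" for z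
      using that by (intro sin_ge_zero) (auto simp: divide_le_eq)
    have "\<bar>sin (pi * (y + 1) / n)\<bar> = sin (pi * (y + 1) / n)" "\<bar>sin (pi * (y - 1) / n)\<bar> = sin (pi * (y - 1) / n)"
      "\<bar>sin (pi * y / n)\<bar> = sin (pi * y / n)"
      using that by (intro abs_of_nonneg nonneg; linarith)+
    then show ?thesis
      by (simp only: split sine_recurrence)
  qed
  show ?thesis
  proof (cases "0 \<le> x")
    case True
    with assms show ?thesis
      by (intro positive) auto
  next
    case False
    have "pi * (- x + 1) / n = - (pi * (x - 1) / n)" "pi * (- x - 1) / n = - (pi * (x + 1) / n)"
      "pi * (- x) / n = - (pi * x / n)"
      unfolding split by simp_all
    moreover from False assms have "\<bar>sin (pi * (- x + 1) / n)\<bar> + \<bar>sin (pi * (- x - 1) / n)\<bar> =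
        2 * cos (pi / n) * \<bar>sin (pi * (- x) / n)\<bar>"
      by (intro positive) auto
    ultimately show ?thesis
      by (simp only: sin_minus abs_minus_cancel add.commute)
  qed
qed

lemma abs_diff_bounds:
  assumes "i < n" "j < n" "i \<noteq> j"
  shows "1 \<le> \<bar>real i - real j\<bar>" "\<bar>real i - real j\<bar> \<le> real n - 1"
  using assms by (auto simp: abs_if)

text \<open>At an end of the path a neighbour is missing; dropping its nonnegative term turns the
  recurrence into an inequality.\<close>

lemma sum_sine_weight_path:
  assumes ij: "i < n" "j < n" "i \<noteq> j"
  shows "(\<Sum>i'\<in>nbhd (path_graph n) i. sine_weight n i' j) \<le> 2 * cos (pi / n) * sine_weight n i j"
proof -
  have "(\<Sum>i'\<in>nbhd (path_graph n) i. sine_weight n i' j) \<le>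
      \<bar>sin (pi * (real i - real j + 1) / n)\<bar> + \<bar>sin (pi * (real i - real j - 1) / n)\<bar>"
    unfolding sum_nbhd_path_graph[OF ij(1)] sine_weight_def
    by (intro add_mono) (simp_all add: algebra_simps of_nat_diff)
  also have "\<dots> = 2 * cos (pi / n) * sine_weight n i j"
    unfolding sine_weight_def using abs_diff_bounds[OF ij] by (rule abs_sine_recurrence)
  finally show ?thesis .
qed

text \<open>Wrapping around shifts the argument of the sine by \<open>pi\<close>, which changes only
  its sign, so the recurrence is exact at every vertex.\<close>

lemma sum_sine_weight_cycle:
  assumes n: "n \<ge> 3" and ij: "i < n" "j < n" "i \<noteq> j"
  shows "(\<Sum>i'\<in>nbhd (cycle_graph n) i. sine_weight n i' j) = 2 * cos (pi / n) * sine_weight n i j"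
proof -
  have periodic: "\<bar>sin (pi * (y + n) / n)\<bar> = \<bar>sin (pi * y / n)\<bar>" for y :: real
  proof -
    have "pi * (y + n) / n = pi * y / n + pi"
      using n by (simp add: field_simps)
    then show ?thesis
      by simp
  qed
  have up: "sine_weight n (if i + 1 = n then 0 else i + 1) j = \<bar>sin (pi * (real i - real j + 1) / n)\<bar>"
    using periodic[of "- real j"] unfolding sine_weight_def
    by (auto simp: algebra_simps)
  have down: "sine_weight n (if i = 0 then n - 1 else i - 1) j = \<bar>sin (pi * (real i - real j - 1) / n)\<bar>"
    using periodic[of "- 1 - real j"] n unfolding sine_weight_def
    by (auto simp: algebra_simps of_nat_diff)
  \<comment> \<open>Since \<open>n \<ge> 3\<close> the two neighbours are distinct and both terms
    are counted.\<close>
  have "(if i + 1 = n then 0 else i + 1) \<noteq> (if i = 0 then n - 1 else i - 1)"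
    using n ij by auto
  then have "(\<Sum>i'\<in>nbhd (cycle_graph n) i. sine_weight n i' j) =
      \<bar>sin (pi * (real i - real j + 1) / n)\<bar> + \<bar>sin (pi * (real i - real j - 1) / n)\<bar>"
    unfolding nbhd_cycle_graph[OF n] up[symmetric] down[symmetric] using ij by simp
  also have "\<dots> = 2 * cos (pi / n) * sine_weight n i j"
    unfolding sine_weight_def using abs_diff_bounds[OF ij] by (rule abs_sine_recurrence)
  finally show ?thesis .
qed

lemma cos_pi_div_nonneg: "n \<ge> 2 \<Longrightarrow> 0 \<le> cos (pi / real n)"
  by (intro cos_ge_zero) (auto simp: field_simps intro: order_trans[of _ 0])

section \<open>Spectra of the 2-token graphs of finite paths and cycles\<close>

lemma path_token2_supersolution:
  assumes "n \<ge> 2"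
  shows "positive_supersolution (token2 (path_graph n)) (pair_lift (sine_weight n)) (4 * cos (pi / n))"
proof (rule locally_finite_graph.token2_positive_supersolution[OF locally_finite_path_graph])
  fix i j assume "i \<in> verts (path_graph n)" "j \<in> verts (path_graph n)" "i \<noteq> j"
  then have ij: "i < n" "j < n" "i \<noteq> j"
    by (simp_all add: path_graph_def)
  then show "0 < sine_weight n i j"
    by (rule sine_weight_pos)
  show "(\<Sum>i'\<in>nbhd (path_graph n) i. sine_weight n i' j) +
      (\<Sum>j'\<in>nbhd (path_graph n) j. sine_weight n i j') \<le> 4 * cos (pi / n) * sine_weight n i j"
    using sum_sine_weight_path[OF ij] sum_sine_weight_path[OF ij(2,1) ij(3)[symmetric]]
    by (simp add: sine_weight_sym[of n i])
qed (use assms in \<open>simp_all add: sine_weight_sym sine_weight_diag cos_pi_div_nonneg\<close>)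

lemma cycle_token2_spectral_radius:
  assumes n: "n \<ge> 3"
  shows "spectral_radius (token2 (cycle_graph n)) = 4 * cos (pi / n)"
proof (rule spectral_radius_eq)
  have verts: "i \<in> verts (cycle_graph n) \<longleftrightarrow> i < n" for i
    by (simp add: cycle_graph_def)
  have eigen: "(\<Sum>i'\<in>nbhd (cycle_graph n) i. sine_weight n i' j) +
      (\<Sum>j'\<in>nbhd (cycle_graph n) j. sine_weight n i j') = 4 * cos (pi / n) * sine_weight n i j"
    if "i \<in> verts (cycle_graph n)" "j \<in> verts (cycle_graph n)" "i \<noteq> j" for i j
    using sum_sine_weight_cycle[OF n, of i j] sum_sine_weight_cycle[OF n, of j i] that
    by (simp add: sine_weight_sym[of n i] verts)
  show "positive_supersolution (token2 (cycle_graph n)) (pair_lift (sine_weight n)) (4 * cos (pi / n))"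
    by (rule locally_finite_graph.token2_positive_supersolution[OF locally_finite_cycle_graph[OF n]
          sine_weight_sym sine_weight_diag _ eq_refl[OF eigen]])
       (use n in \<open>simp_all add: sine_weight_pos verts cos_pi_div_nonneg\<close>)
  show "complex_of_real (4 * cos (pi / n)) \<in>
      op_spectrum (verts (token2 (cycle_graph n))) (adj_op (token2 (cycle_graph n)))"
  proof (rule locally_finite_graph.token2_eigenvalue[OF locally_finite_cycle_graph[OF n]
        sine_weight_sym sine_weight_diag _ eigen])
    show "finite (verts (cycle_graph n))"
      by (simp add: cycle_graph_def)
    show "0 \<in> verts (cycle_graph n)" "1 \<in> verts (cycle_graph n)"
      using n by (simp_all add: verts)
    show "sine_weight n 0 1 \<noteq> 0"
      using n sine_weight_pos[of 0 n 1] by simp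
  qed
qed

text \<open>Two tokens on a path behave like free fermions: the wave functions are the antisymmetrised
  products of the one-particle Dirichlet modes \<open>sin (t * (real i + 1))\<close>. Two modes already show that the
  spectrum is nonempty.\<close>

definition slater :: "real \<Rightarrow> nat \<Rightarrow> nat \<Rightarrow> real" where
  "slater t i j = sin (t * (real i + 1)) * sin (2 * t * (real j + 1)) - sin (t * (real j + 1)) * sin (2 * t * (real i + 1))"

text \<open>The mode vanishes at the fictitious positions \<open>-1\<close>, by the index shift, and
  \<open>n\<close>, by assumption; missing end neighbours can thus be added and the sine recurrence
  applies.\<close>

lemma sum_nbhd_path_sine:
  fixes t :: real
  assumes "i < n" "sin (t * (real n + 1)) = 0"
  shows "(\<Sum>i'\<in>nbhd (path_graph n) i. sin (t * (real i' + 1))) = 2 * cos t * sin (t * (real i + 1))"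
proof -
  have "(if i + 1 < n then sin (t * (real (i + 1) + 1)) else 0) = sin (t * (real i + 1) + t)"
  proof (cases "i + 1 < n")
    case False
    with assms(1) have "n = i + 1" by simp
    with assms(2) show ?thesis by (simp add: algebra_simps)
  qed (simp add: algebra_simps)
  moreover have "(if i = 0 then 0 else sin (t * (real (i - 1) + 1))) = sin (t * (real i + 1) - t)"
    by (simp add: algebra_simps of_nat_diff)
  ultimately show ?thesis
    unfolding sum_nbhd_path_graph[OF assms(1)] using sine_recurrence[of "t * (real i + 1)" t] by simp
qed

lemma path_token2_spectrum_nonempty:
  assumes n: "n \<ge> 2"
  shows "op_spectrum (verts (token2 (path_graph n))) (adj_op (token2 (path_graph n))) \<noteq> {}"
proof -
  \<comment> \<open>With this choice both frequencies \<open>t\<close> and \<open>2 * t\<close>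
    satisfy the boundary condition at position \<open>n\<close>.\<close>
  define t where "t = pi / (real n + 1)"
  \<comment> \<open>\<open>slater\<close> is antisymmetric; sorting its arguments gives the
    symmetric function that a lift to pairs requires.\<close>
  define h where "h i j = slater t (min i j) (max i j)" for i j
  have verts: "i \<in> verts (path_graph n) \<longleftrightarrow> i < n" for i
    by (simp add: path_graph_def)
  have sym: "h i j = h j i" for i j
    by (simp add: h_def min.commute max.commute)
  have diag: "h i i = 0" for i
    by (simp add: h_def slater_def)
  have eq: "t * (real n + 1) = pi"
    by (simp add: t_def)
  then have "2 * t * (real n + 1) = 2 * pi"
    by simp
  with eq have boundary: "sin (t * (real n + 1)) = 0" "sin (2 * t * (real n + 1)) = 0"
    by (simp_all only: sin_pi sin_two_pi)
  have mode: "(\<Sum>i'\<in>nbhd (path_graph n) i. slater t i' j) + (\<Sum>j'\<in>nbhd (path_graph n) j. slater t i j')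
      = (2 * cos t + 2 * cos (2 * t)) * slater t i j" if "i < n" "j < n" for i j
    unfolding slater_def sum_subtractf
      sum_distrib_left[symmetric] sum_distrib_right[symmetric]
      sum_nbhd_path_sine[OF that(1) boundary(1)] sum_nbhd_path_sine[OF that(1) boundary(2)]
      sum_nbhd_path_sine[OF that(2) boundary(1)] sum_nbhd_path_sine[OF that(2) boundary(2)]
    by (simp add: algebra_simps)
  have ordered: "(\<Sum>i'\<in>nbhd (path_graph n) i. h i' j) + (\<Sum>j'\<in>nbhd (path_graph n) j. h i j')
      = (2 * cos t + 2 * cos (2 * t)) * h i j" if "i < j" "j < n" for i j
  proof -
    \<comment> \<open>One step takes a token at most onto the other, never past it, so
      \<open>min\<close> and \<open>max\<close> keep the arguments in place.\<close>
    have "h i' j = slater t i' j" if "i' \<in> nbhd (path_graph n) i" for i'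
      using that \<open>i < j\<close> by (auto simp: h_def nbhd_path_graph split: if_splits)
    moreover have "h i j' = slater t i j'" if "j' \<in> nbhd (path_graph n) j" for j'
      using that \<open>i < j\<close> by (auto simp: h_def nbhd_path_graph split: if_splits)
    moreover have "h i j = slater t i j"
      using \<open>i < j\<close> by (simp add: h_def)
    ultimately show ?thesis
      using mode[of i j] that by simp
  qed
  have eigen: "(\<Sum>i'\<in>nbhd (path_graph n) i. h i' j) + (\<Sum>j'\<in>nbhd (path_graph n) j. h i j')
      = (2 * cos t + 2 * cos (2 * t)) * h i j"
    if "i \<in> verts (path_graph n)" "j \<in> verts (path_graph n)" "i \<noteq> j" for i j
  proof (cases "i < j")
    case True
    with that show ?thesis
      by (intro ordered) (simp_all add: verts)
  next
    case False
    have "(\<Sum>i'\<in>nbhd (path_graph n) i. h i' j) = (\<Sum>i'\<in>nbhd (path_graph n) i. h j i')"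
      "(\<Sum>j'\<in>nbhd (path_graph n) j. h i j') = (\<Sum>j'\<in>nbhd (path_graph n) j. h j' i)"
      by (rule sum.cong[OF refl sym])+
    with False that ordered[of j i] sym[of i j] show ?thesis
      by (simp add: verts add.commute)
  qed
  have t: "0 < t" "t < pi / 2"
    using n by (auto simp: t_def field_simps)
  \<comment> \<open>The factorisation shows that the eigenfunction is not identically zero: no
    factor vanishes for \<open>0 < t < pi / 2\<close>.\<close>
  have "h 0 1 = 4 * (sin t)\<^sup>2 * cos t * (cos (2 * t) - cos t)"
  proof -
    have args: "t * (real 0 + 1) = t" "2 * t * (real 0 + 1) = 2 * t"
      "t * (real 1 + 1) = 2 * t" "2 * t * (real 1 + 1) = 2 * (2 * t)"
      by simp_all
    have "h 0 1 = slater t 0 1"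
      by (simp add: h_def)
    then show ?thesis
      unfolding slater_def args sin_double by (simp add: power2_eq_square algebra_simps)
  qed
  moreover have "cos (2 * t) < cos t"
    using t by (intro cos_monotone_0_pi) auto
  ultimately have "h 0 1 \<noteq> 0"
    using t sin_gt_zero[of t] cos_gt_zero[of t] by simp
  then have "complex_of_real (2 * cos t + 2 * cos (2 * t)) \<in>
      op_spectrum (verts (token2 (path_graph n))) (adj_op (token2 (path_graph n)))"
    using n by (intro locally_finite_graph.token2_eigenvalue[OF locally_finite_path_graph sym diag _ eigen,
          where x = 0 and y = 1]) (simp_all add: path_graph_def)
  then show ?thesis
    by blast
qed

section \<open>Complete bipartite graphs\<close>

text \<open>The ratio of the two values solves \<open>l a = 2 n b\<close> and \<open>l b = 2 (n - 1) a\<close>. For \<open>n = 1\<close> no pair lies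
  inside a part; the value 1 keeps the weight positive on the single mixed pair.\<close>

definition side_weight :: "nat \<Rightarrow> nat + nat \<Rightarrow> nat + nat \<Rightarrow> real" where
  "side_weight n x y = (if x = y then 0 else if isl x = isl y then sqrt n
     else if n = 1 then 1 else sqrt (real n - 1))"

lemma side_weight_sym: "side_weight n x y = side_weight n y x"
  by (simp add: side_weight_def eq_commute)

lemma side_weight_simps:
  "side_weight n (Inl i) (Inl j) = (if i = j then 0 else sqrt n)"
  "side_weight n (Inr i) (Inr j) = (if i = j then 0 else sqrt n)"
  "side_weight n (Inl i) (Inr j) = (if n = 1 then 1 else sqrt (real n - 1))"
  "side_weight n (Inr i) (Inl j) = (if n = 1 then 1 else sqrt (real n - 1))"
  unfolding side_weight_def by simp_all

lemma nbhd_complete_bipartite_graph: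
  "nbhd (complete_bipartite_graph n n) (Inl i) = (if i < n then Inr ` {..<n} else {})"
  "nbhd (complete_bipartite_graph n n) (Inr i) = (if i < n then Inl ` {..<n} else {})"
  by (auto simp: nbhd_def complete_bipartite_graph_def doubleton_eq_iff)

lemma locally_finite_complete_bipartite_graph:
  "locally_finite_graph (complete_bipartite_graph n n)"
proof
  fix v :: "nat + nat"
  show "finite (nbhd (complete_bipartite_graph n n) v)" "v \<notin> nbhd (complete_bipartite_graph n n) v"
    by (cases v; auto simp: nbhd_complete_bipartite_graph)+
qed

lemma complete_bipartite_token2_spectral_radius:
  assumes n: "n \<ge> 1"
  shows "spectral_radius (token2 (complete_bipartite_graph n n)) = 2 * sqrt (n * (real n - 1))"
proof (rule spectral_radius_eq)
  let ?K = "complete_bipartite_graph n n" and ?h = "side_weight n"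
  have fin: "finite (verts ?K)"
    by (simp add: complete_bipartite_graph_def)
  let ?r = "sqrt (real n * (real n - 1))"
  \<comment> \<open>Starting with both tokens in one part, the moving token has \<open>n\<close>
    free places in the other part, each giving a mixed pair.\<close>
  have mixed: "(\<Sum>k<n. if n = 1 then 1 else sqrt (real n - 1)) = ?r * sqrt n" if "n \<noteq> 1"
    using n that by (simp add: real_sqrt_mult)
  \<comment> \<open>Starting from a mixed pair, the moving token joins the part of the other token,
    whose place \<open>j\<close> is occupied.\<close>
  have same: "(\<Sum>k<n. if k = j then 0 else sqrt n) = ?r * (if n = 1 then 1 else sqrt (real n - 1))"
    if "j < n" for j
  proof -
    have "(\<Sum>k<n. if k = j then 0 else sqrt n) = (\<Sum>k<n. sqrt n - (if k = j then sqrt n else 0))"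
      by (intro sum.cong) auto
    also have "\<dots> = (real n - 1) * sqrt n"
      using that by (simp add: sum_subtractf algebra_simps)
    finally show ?thesis
      using n by (simp add: real_sqrt_mult)
  qed
  have eigen: "(\<Sum>x'\<in>nbhd ?K x. ?h x' y) + (\<Sum>y'\<in>nbhd ?K y. ?h x y') =
      2 * ?r * ?h x y"
    if "x \<in> verts ?K" "y \<in> verts ?K" "x \<noteq> y" for x y
  proof -
    have verts: "Inl i \<in> verts ?K \<longleftrightarrow> i < n" "Inr i \<in> verts ?K \<longleftrightarrow> i < n" for i
      by (auto simp: complete_bipartite_graph_def)
    \<comment> \<open>Each token contributes half of the eigenvalue.\<close>
    have half: "(\<Sum>x'\<in>nbhd ?K x. ?h x' y) = ?r * ?h x y"
      if "x \<in> verts ?K" "y \<in> verts ?K" "x \<noteq> y" for x y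
    proof -
      have "n \<noteq> 1" if "isl x = isl y"
        using that \<open>x \<in> _\<close> \<open>y \<in> _\<close> \<open>x \<noteq> y\<close> by (cases x; cases y) (auto simp: verts)
      then show ?thesis
        using that mixed same
        by (cases x; cases y)
           (auto simp: verts nbhd_complete_bipartite_graph sum.reindex side_weight_simps)
    qed
    show ?thesis
      using half[OF that] half[OF that(2,1) that(3)[symmetric]]
      by (simp add: side_weight_sym[of n x])
  qed
  show "positive_supersolution (token2 ?K) (pair_lift ?h) (2 * sqrt (n * (real n - 1)))"
    by (rule locally_finite_graph.token2_positive_supersolution[OF
          locally_finite_complete_bipartite_graph side_weight_sym _ _ eq_refl[OF eigen]])
       (use n in \<open>simp_all add: side_weight_def\<close>)
  show "complex_of_real (2 * sqrt (n * (real n - 1))) \<in> op_spectrum (verts (token2 ?K)) (adj_op (token2 ?K))"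
    by (rule locally_finite_graph.token2_eigenvalue[OF
          locally_finite_complete_bipartite_graph side_weight_sym _ fin eigen, where x = "Inl 0" and y = "Inr 0"])
       (use n in \<open>auto simp: side_weight_def complete_bipartite_graph_def\<close>)
qed

theorem corollary4p3:
  shows "((\<forall>n::nat. n \<ge> 2 \<longrightarrow> spectral_radius (token2 (path_graph n)) \<le> 4 * cos (pi / real n))
           \<and> spectral_radius (token2 inf_path_graph) = 4)
       \<and> ((\<forall>n::nat. n \<ge> 3 \<longrightarrow> spectral_radius (token2 (cycle_graph n)) = 4 * cos (pi / real n))
           \<and> spectral_radius (token2 inf_cycle_graph) = 4)
       \<and> (\<forall>n::nat. n \<ge> 1 \<longrightarrow>
            spectral_radius (token2 (complete_bipartite_graph n n)) = 2 * sqrt (real n * (real n - 1)))"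
  using spectral_radius_le[OF path_token2_supersolution path_token2_spectrum_nonempty]
    inf_path_token2_spectral_radius cycle_token2_spectral_radius inf_cycle_token2_spectral_radius
    complete_bipartite_token2_spectral_radius
  by blast

end
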